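(* Let $X$ be a real locally convex Hausdorff topological vector space, $T$ a nonempty index set, $a_t\in X^*$ and $b_t\in\mathbb R$ for $t\in T$, and assume $\{x\in X:\langle a_t,x\rangle\le b_t\ \forall t\in T\}\ne\emptyset$. The following statements are equivalent: (i) For all $(c,s)\in X^*\times\mathbb R$ the next two assertions are equivalent: $\quad(\alpha')$ for every $x\in X$: $\ \big[\langle a_t,x\rangle\le b_t\ \ \forall t\in T\big]\Longrightarrow\langle c,x\rangle\ge s$; $\quad(\delta')$ there exists $\bar\lambda\ge0$ such that for all $x\in X$ and all $\varepsilon>0$ there exists $t_0\in T$ with $\langle c+\bar\lambda a_{t_0},x\rangle-\bar\lambda b_{t_0}+\varepsilon\ge s$. (ii) $\operatorname{cone}\overline{\operatorname{co}}\big(\{(a_t,b_t):t\in T\}\cup\{(0_{X^*},1)\}\big)$ is a closed subset of $X^*\times\mathbb R$.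
   Context: $X^*$ is the topological dual of $X$ with the weak* topology; $X^*\times\mathbb R$ has the product topology. $\operatorname{cone}B=\{\lambda b:\lambda\ge0,b\in B\}$, $\overline{\operatorname{co}}$ is the closed convex hull. *)

theory Defs
  imports "HOL-Analysis.Analysis"
begin

class topological_real_vector = real_vector + topological_ab_group_add +
  assumes tendsto_scaleR_Pair:
    "((\<lambda>p. fst p *\<^sub>R snd p) \<longlongrightarrow> r *\<^sub>R x) (nhds r \<times>\<^sub>F nhds x)"

text \<open>
  Translations are homeomorphisms, so a base of convex neighbourhoods at the origin gives one
  at every point.  Convexity is written out because \<^const>\<open>convex\<close> is not available on the
  type parameter inside a class specification.
\<close>

class locally_convex_t2_space = topological_real_vector + t2_space +
  assumes convex_nhds_zero:
    "open U \<Longrightarrow> 0 \<in> U \<Longrightarrow> \<exists>V. open V \<and> 0 \<in> V \<and> V \<subseteq> U \<and>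
       (\<forall>x\<in>V. \<forall>y\<in>V. \<forall>u\<ge>0. \<forall>v\<ge>0. u + v = 1 \<longrightarrow> u *\<^sub>R x + v *\<^sub>R y \<in> V)"

lemma locally_convex_zero:
  fixes U :: "'a::locally_convex_t2_space set"
  assumes "open U" "0 \<in> U"
  shows "\<exists>V. open V \<and> convex V \<and> 0 \<in> V \<and> V \<subseteq> U"
  using convex_nhds_zero[OF assms] unfolding convex_def by blast

typedef (overloaded) ('a :: "{real_vector, topological_space}") dual =
  "{f :: 'a \<Rightarrow> real. linear f \<and> continuous_on UNIV f}"
  morphisms pairing Abs_dual
proof
  show "(\<lambda>_. 0) \<in> {f :: 'a \<Rightarrow> real. linear f \<and> continuous_on UNIV f}"
    by (simp add: linear_iff)
qed

setup_lifting type_definition_dual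

instantiation dual :: ("{real_vector, topological_space}") real_vector
begin

lift_definition zero_dual :: "'a dual" is "\<lambda>_. 0"
  by (simp add: linear_iff)

lift_definition plus_dual :: "'a dual \<Rightarrow> 'a dual \<Rightarrow> 'a dual" is "\<lambda>f g x. f x + g x"
  by (auto simp: linear_iff algebra_simps intro!: continuous_intros)

lift_definition uminus_dual :: "'a dual \<Rightarrow> 'a dual" is "\<lambda>f x. - f x"
  by (auto simp: linear_iff intro!: continuous_intros)

lift_definition minus_dual :: "'a dual \<Rightarrow> 'a dual \<Rightarrow> 'a dual" is "\<lambda>f g x. f x - g x"
  by (auto simp: linear_iff algebra_simps intro!: continuous_intros)

lift_definition scaleR_dual :: "real \<Rightarrow> 'a dual \<Rightarrow> 'a dual" is "\<lambda>r f x. r *\<^sub>R f x"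
  by (auto simp: linear_iff algebra_simps intro!: continuous_intros)

instance
  by standard (transfer; simp add: fun_eq_iff algebra_simps)+

end

text \<open>The weak* topology: the coarsest one making every evaluation at a point continuous.\<close>

instantiation dual :: ("{real_vector, topological_space}") topological_space
begin

definition open_dual :: "'a dual set \<Rightarrow> bool" where
  "open_dual = generate_topology {(\<lambda>f. pairing f x) -` W | x W. open W}"

instance
  by standard (simp_all add: open_dual_def generate_topology.intros)

end

text \<open>
  Unlike \<^const>\<open>cone\<close>, which is a predicate, and \<^const>\<open>hull\<close>, this is literally the set of
  nonnegative multiples; convexity is not enforced.
\<close>

definition cone_of :: "'a::real_vector set \<Rightarrow> 'a set" where
  "cone_of B = {r *\<^sub>R v | r v. 0 \<le> r \<and> v \<in> B}"

end

theory Submission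
  imports Defs
begin

text \<open>
  Let \<open>N\<close> be the weak* closed convex cone of all \<open>(p, q)\<close> such that \<open>p \<le> q\<close> holds on the solution
  set, and \<open>M \<subseteq> N\<close> the cone in (ii).  Condition \<open>(\<alpha>')\<close> says \<open>(- c, - s) \<in> N\<close>, and Farkas' lemma
  gives \<open>N \<subseteq> closure M\<close>, so \<open>M\<close> is closed iff \<open>M = N\<close>.  The pairs satisfying \<open>(\<delta>')\<close> form a subset
  of \<open>M\<close>, by separation and compactness of the interval of convex weights; in general it is a
  proper subset.  If \<open>M = N\<close>, take \<open>(p, q) \<in> N\<close> and lower \<open>q\<close> to the supremum of \<open>p\<close> over the
  solution set.  The resulting pair lies in \<open>M = N\<close>, and by minimality of its second component the
  generator \<open>(0, 1)\<close> contributes nothing to it: it is a multiple of a limit of convex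
  combinations of the \<open>(a t, b t)\<close>, which is \<open>(\<delta>')\<close>.
\<close>

section \<open>Topological and finite-dimensional preliminaries\<close>

text \<open>Tube lemma: if \<open>{w} \<times> K\<close> missed \<open>closure G\<close>, so would
  \<open>U \<times> K\<close> for a neighbourhood \<open>U\<close> of \<open>w\<close>, yet
  \<open>U\<close> meets the projection of \<open>G\<close>. This replaces passing to a convergent
  subnet of weights when a point is approximated by convex combinations.\<close>

lemma mem_closure_fst_imp_compact:
  fixes G :: "('a::topological_space \<times> 'b::topological_space) set"
  assumes "compact K" "snd ` G \<subseteq> K" "w \<in> closure (fst ` G)"
  obtains \<mu> where "\<mu> \<in> K" "(w, \<mu>) \<in> closure G"
proof (rule ccontr)
  assume "\<not> thesis"
  then have "{w} \<times> K \<subseteq> - closure G"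
    using that by auto
  moreover have "open (- closure G)"
    by (simp add: open_Compl)
  ultimately obtain U where U: "w \<in> U" "open U" "U \<times> K \<subseteq> - closure G"
    using Elementary_Topology.tube_lemma[OF assms(1)] by blast
  from assms(3) U(1,2) have "fst ` G \<inter> U \<noteq> {}"
    using closure_iff_nhds_not_empty by blast
  then obtain y \<nu> where "(y, \<nu>) \<in> G" "y \<in> U" by auto
  with U(3) assms(2) closure_subset[of G] show False by force
qed

text \<open>The separating functional is read off the nearest point, in the finite-dimensional space of
  values of the \<open>f i\<close>, to the image of \<open>w\<close> in the closure of the image of \<open>S\<close>.\<close>

lemma separation_finitely_many_functionals:
  fixes f :: "'i \<Rightarrow> 'v::real_vector \<Rightarrow> real"
  assumes "finite I" and lin: "\<And>i. i \<in> I \<Longrightarrow> linear (f i)"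
    and "convex S" "\<epsilon> > 0"
    and far: "\<And>s. s \<in> S \<Longrightarrow> \<exists>i\<in>I. \<epsilon> \<le> \<bar>f i s - f i w\<bar>"
  obtains u \<delta> where "\<delta> > 0" "\<And>s. s \<in> S \<Longrightarrow> (\<Sum>i\<in>I. u i * f i w) + \<delta> \<le> (\<Sum>i\<in>I. u i * f i s)"
proof (cases "S = {}")
  case True
  then show ?thesis using that[of 1 "\<lambda>_. 0"] by simp
next
  case False
  define h where "h i s = f i s - f i w" for i s
  define Q where "Q s = (\<Sum>i\<in>I. (h i s)\<^sup>2)" for s
  define m where "m = Inf (Q ` S)"
  have h_conv: "h i ((1 - t) *\<^sub>R x + t *\<^sub>R y) = (1 - t) * h i x + t * h i y"
    if "i \<in> I" for i t x y
    using lin[OF that] by (simp add: h_def linear_add linear_diff linear_scale algebra_simps)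
  have Q_nonneg: "0 \<le> Q s" for s
    by (simp add: Q_def sum_nonneg)
  have bdd: "bdd_below (Q ` S)"
    using Q_nonneg by (rule bdd_belowI2)
  have m_le: "m \<le> Q s" if "s \<in> S" for s
    unfolding m_def using bdd that by (simp add: cInf_lower)
  have "\<exists>s\<in>S. Q s < m + 1 / real (Suc k)" for k
    using cInf_lessD[of "Q ` S" "m + 1 / real (Suc k)"] False by (auto simp: m_def)
  then obtain \<sigma> where \<sigma>: "\<And>k. \<sigma> k \<in> S" "\<And>k. Q (\<sigma> k) < m + 1 / real (Suc k)"
    by metis
  \<comment> \<open>Parallelogram identity: the midpoint \<open>p\<close> lies in \<open>S\<close>,
    so \<open>Q p\<close> is at least \<open>m\<close>, which forces the images of near-minimal
    points close together. Hence the minimizing sequence is Cauchy in every coordinate.\<close>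
  have diff: "(h i (\<sigma> j) - h i (\<sigma> k))\<^sup>2 \<le> 2 * (1 / real (Suc j)) + 2 * (1 / real (Suc k))"
    if "i \<in> I" for i j k
  proof -
    define p where "p = (1 - 1/2) *\<^sub>R \<sigma> j + (1/2) *\<^sub>R \<sigma> k"
    have "p \<in> S"
      unfolding p_def by (rule convexD[OF \<open>convex S\<close>]) (use \<sigma> in auto)
    have hp: "h i p = (h i (\<sigma> j) + h i (\<sigma> k)) / 2" if "i \<in> I" for i
      using h_conv[OF that, of "1/2"] by (simp only: p_def) simp
    have "(h i (\<sigma> j) - h i (\<sigma> k))\<^sup>2 \<le> (\<Sum>i\<in>I. (h i (\<sigma> j) - h i (\<sigma> k))\<^sup>2)"
      by (rule member_le_sum) (use that \<open>finite I\<close> in auto)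
    also have "\<dots> = (\<Sum>i\<in>I. 2 * (h i (\<sigma> j))\<^sup>2 + 2 * (h i (\<sigma> k))\<^sup>2 - 4 * (h i p)\<^sup>2)"
      by (rule sum.cong) (auto simp: hp power2_eq_square field_simps)
    also have "\<dots> = 2 * Q (\<sigma> j) + 2 * Q (\<sigma> k) - 4 * Q p"
      by (simp add: Q_def sum.distrib sum_subtractf sum_distrib_left)
    also have "\<dots> \<le> 2 * (1 / real (Suc j)) + 2 * (1 / real (Suc k))"
      using \<sigma>(2)[of j] \<sigma>(2)[of k] m_le[OF \<open>p \<in> S\<close>] by argo
    finally show ?thesis .
  qed
  have "convergent (\<lambda>k. h i (\<sigma> k))" if "i \<in> I" for i
  proof -
    have "Cauchy (\<lambda>k. h i (\<sigma> k))"
    proof (rule metric_CauchyI)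
      fix e :: real
      assume "e > 0"
      then obtain N where N: "4 / e\<^sup>2 < real N"
        using reals_Archimedean2 by blast
      have "dist (h i (\<sigma> j)) (h i (\<sigma> k)) < e" if "j \<ge> N" "k \<ge> N" for j k
      proof -
        have "N > 0" using N \<open>e > 0\<close> by (cases N) (auto simp: divide_less_0_iff)
        have le: "1 / real (Suc n) \<le> 1 / real N" if "n \<ge> N" for n
          using that \<open>N > 0\<close> by (intro divide_left_mono) auto
        have "(h i (\<sigma> j) - h i (\<sigma> k))\<^sup>2 \<le> 4 / real N"
          using diff[OF \<open>i \<in> I\<close>, of j k] le[OF that(1)] le[OF that(2)] by argo
        also have "\<dots> < e\<^sup>2"
          using N \<open>e > 0\<close> \<open>N > 0\<close> by (simp add: field_simps)
        finally have "\<bar>h i (\<sigma> j) - h i (\<sigma> k)\<bar> < e"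
          using \<open>e > 0\<close> power2_less_imp_less[of "\<bar>h i (\<sigma> j) - h i (\<sigma> k)\<bar>" e] by simp
        then show ?thesis by (simp add: dist_real_def)
      qed
      then show "\<exists>N. \<forall>j\<ge>N. \<forall>k\<ge>N. dist (h i (\<sigma> j)) (h i (\<sigma> k)) < e" by blast
    qed
    then show ?thesis by (simp add: Cauchy_convergent_iff)
  qed
  then obtain v where v: "\<And>i. i \<in> I \<Longrightarrow> (\<lambda>k. h i (\<sigma> k)) \<longlonglongrightarrow> v i"
    unfolding convergent_def by metis
  have Q_lim: "(\<lambda>k. Q (\<sigma> k)) \<longlonglongrightarrow> (\<Sum>i\<in>I. (v i)\<^sup>2)"
    unfolding Q_def by (intro tendsto_intros v)
  have "(\<lambda>k. m + 1 / real (Suc k)) \<longlonglongrightarrow> m + 0"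
    by (intro tendsto_intros LIMSEQ_Suc lim_1_over_n)
  then have "(\<lambda>k. m + 1 / real (Suc k)) \<longlonglongrightarrow> m" by simp
  from LIMSEQ_le[OF Q_lim this] \<sigma>(2) have v_le: "(\<Sum>i\<in>I. (v i)\<^sup>2) \<le> m"
    by (meson less_imp_le)
  have "\<epsilon>\<^sup>2 \<le> Q s" if s: "s \<in> S" for s
  proof -
    obtain i where i: "i \<in> I" "\<epsilon> \<le> \<bar>h i s\<bar>"
      using far[OF s] by (auto simp: h_def)
    have "\<epsilon>\<^sup>2 \<le> (h i s)\<^sup>2"
      using i \<open>\<epsilon> > 0\<close> by (metis less_imp_le power2_abs power_mono)
    also have "\<dots> \<le> Q s"
      unfolding Q_def by (rule member_le_sum) (use i \<open>finite I\<close> in auto)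
    finally show ?thesis .
  qed
  then have v_ge: "\<epsilon>\<^sup>2 \<le> (\<Sum>i\<in>I. (v i)\<^sup>2)"
    using LIMSEQ_le_const[OF Q_lim] \<sigma>(1) by blast
  \<comment> \<open>Variational inequality for the nearest point. Since \<open>v\<close> is only a
    limit of images, the segments run from \<open>\<sigma> k\<close> to \<open>s\<close>; the bound
    \<open>m\<close> passes to the limit in \<open>k\<close>, then one divides by \<open>t\<close>
    and lets \<open>t\<close> tend to 0.\<close>
  have main: "(\<Sum>i\<in>I. (v i)\<^sup>2) \<le> (\<Sum>i\<in>I. v i * h i s)" if s: "s \<in> S" for s
  proof -
    define P R where "P = (\<Sum>i\<in>I. v i * (h i s - v i))" and "R = (\<Sum>i\<in>I. (h i s - v i)\<^sup>2)"
    have step: "0 \<le> 2 * P + t * R" if t: "0 < t" "t \<le> 1" for t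
    proof -
      have "(\<lambda>k. Q ((1 - t) *\<^sub>R \<sigma> k + t *\<^sub>R s)) = (\<lambda>k. \<Sum>i\<in>I. ((1 - t) * h i (\<sigma> k) + t * h i s)\<^sup>2)"
        by (simp add: Q_def h_conv)
      moreover have "\<dots> \<longlonglongrightarrow> (\<Sum>i\<in>I. ((1 - t) * v i + t * h i s)\<^sup>2)"
        by (intro tendsto_intros v)
      ultimately have "(\<lambda>k. Q ((1 - t) *\<^sub>R \<sigma> k + t *\<^sub>R s)) \<longlonglongrightarrow> (\<Sum>i\<in>I. ((1 - t) * v i + t * h i s)\<^sup>2)"
        by simp
      then have "m \<le> (\<Sum>i\<in>I. ((1 - t) * v i + t * h i s)\<^sup>2)"
      proof (rule LIMSEQ_le_const)
        have "m \<le> Q ((1 - t) *\<^sub>R \<sigma> k + t *\<^sub>R s)" for k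
        by (intro m_le convexD[OF \<open>convex S\<close> \<sigma>(1) s]) (use t in auto)
        then show "\<exists>N. \<forall>k\<ge>N. m \<le> Q ((1 - t) *\<^sub>R \<sigma> k + t *\<^sub>R s)" by blast
      qed
      also have "\<dots> = (\<Sum>i\<in>I. (v i)\<^sup>2 + 2 * t * (v i * (h i s - v i)) + t\<^sup>2 * (h i s - v i)\<^sup>2)"
        by (rule sum.cong) (auto simp: power2_eq_square algebra_simps)
      also have "\<dots> = (\<Sum>i\<in>I. (v i)\<^sup>2) + 2 * t * P + t\<^sup>2 * R"
        by (simp add: P_def R_def sum.distrib sum_distrib_left)
      finally have "0 \<le> t * (2 * P + t * R)"
        using v_le by (simp add: power2_eq_square algebra_simps)
      then show ?thesis using t by (simp add: zero_le_mult_iff)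
    qed
    have "((\<lambda>t. 2 * P + t * R) \<longlongrightarrow> 2 * P + 0 * R) (at_right 0)"
      by (intro tendsto_intros)
    moreover have "\<forall>\<^sub>F t in at_right 0. 0 \<le> 2 * P + t * R"
      using step by (auto simp: eventually_at_right_field intro!: exI[of _ 1])
    ultimately have "0 \<le> 2 * P + 0 * R"
      by (rule tendsto_lowerbound) simp
    then show ?thesis
      by (simp add: P_def algebra_simps sum_subtractf power2_eq_square)
  qed
  show ?thesis
  proof (rule that)
    show "\<epsilon>\<^sup>2 > 0" using \<open>\<epsilon> > 0\<close> by simp
    fix s assume "s \<in> S"
    then show "(\<Sum>i\<in>I. v i * f i w) + \<epsilon>\<^sup>2 \<le> (\<Sum>i\<in>I. v i * f i s)"
      using main[of s] v_ge by (simp add: h_def algebra_simps sum_subtractf)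
  qed
qed

section \<open>The weak* topology and strict separation in the dual times the reals\<close>

text \<open>Induction over the generated topology: a subbasic set contributes one evaluation point,
  and an intersection merges the point sets and keeps the smaller radius.\<close>

lemma dual_open_contains_basic:
  fixes p :: "'x::{real_vector, topological_space} dual"
  assumes "open A" "p \<in> A"
  obtains F \<epsilon> where "finite F" "\<epsilon> > 0"
    "\<forall>p'. (\<forall>x\<in>F. \<bar>pairing p' x - pairing p x\<bar> < \<epsilon>) \<longrightarrow> p' \<in> A"
proof -
  let ?B = "\<lambda>A. \<exists>F \<epsilon>. finite F \<and> \<epsilon> > 0 \<and>
    (\<forall>p'. (\<forall>x\<in>F. \<bar>pairing p' x - pairing p x\<bar> < \<epsilon>) \<longrightarrow> p' \<in> A)"
  have "p \<in> A \<longrightarrow> ?B A"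
    using assms(1) unfolding open_dual_def
  proof induction
    case UNIV
    show ?case by (auto intro!: exI[of _ "{}"] exI[of _ 1])
  next
    case (Int A1 A2)
    show ?case
    proof
      assume "p \<in> A1 \<inter> A2"
      with Int obtain F1 \<epsilon>1 F2 \<epsilon>2 where
        "finite F1" "\<epsilon>1 > 0" "\<forall>p'. (\<forall>x\<in>F1. \<bar>pairing p' x - pairing p x\<bar> < \<epsilon>1) \<longrightarrow> p' \<in> A1"
        "finite F2" "\<epsilon>2 > 0" "\<forall>p'. (\<forall>x\<in>F2. \<bar>pairing p' x - pairing p x\<bar> < \<epsilon>2) \<longrightarrow> p' \<in> A2"
        by auto
      then show "?B (A1 \<inter> A2)"
        by (intro exI[of _ "F1 \<union> F2"] exI[of _ "min \<epsilon>1 \<epsilon>2"]) auto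
    qed
  next
    case (UN K)
    then show ?case by (meson Union_iff)
  next
    case (Basis A)
    then obtain x W where A: "A = (\<lambda>f. pairing f x) -` W" "open W" by blast
    show ?case
    proof
      assume "p \<in> A"
      then obtain e where "e > 0" "\<And>y. dist y (pairing p x) < e \<Longrightarrow> y \<in> W"
        using A by (auto simp: open_dist)
      then show "?B A"
        using A by (intro exI[of _ "{x}"] exI[of _ e]) (auto simp: dist_real_def)
    qed
  qed
  then have "?B A" using assms(2) by (rule mp)
  then show ?thesis
    by (elim exE conjE) (rule that)
qed

text \<open>Points of X x R serve as functionals on the dual times the reals. At
  \<open>(x, -1)\<close> the value on \<open>(p, q)\<close> is \<open>pairing p x - q\<close>, so an
  inequality of the system becomes nonpositivity.\<close>

definition affine_pairing ::
    "'x::{real_vector, topological_space} \<times> real \<Rightarrow> 'x dual \<times> real \<Rightarrow> real" where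
  "affine_pairing z w = pairing (fst w) (fst z) + snd z * snd w"

lemma affine_pairing_Pair: "affine_pairing (x, r) (p, q) = pairing p x + r * q"
  by (simp add: affine_pairing_def)

lemma linear_pairing: "linear (pairing p)"
  using pairing[of p] by simp

lemma linear_affine_pairing: "linear (affine_pairing z)"
proof (rule linearI)
  show "affine_pairing z (v + w) = affine_pairing z v + affine_pairing z w" for v w
    by (simp add: affine_pairing_def plus_dual.rep_eq distrib_left)
  show "affine_pairing z (r *\<^sub>R w) = r *\<^sub>R affine_pairing z w" for r w
    by (simp add: affine_pairing_def scaleR_dual.rep_eq distrib_left)
qed

text \<open>Collapses the combination of functionals produced by finite-dimensional separation into
  a single point of X x R.\<close>

lemma affine_pairing_sum_left:
  "(\<Sum>i\<in>I. u i * affine_pairing (z i) w) = affine_pairing (\<Sum>i\<in>I. u i *\<^sub>R z i) w"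
proof -
  have "linear (\<lambda>z. affine_pairing z w)"
  proof (rule linearI)
    show "affine_pairing (y + z) w = affine_pairing y w + affine_pairing z w" for y z
      by (simp add: affine_pairing_def linear_add[OF linear_pairing] distrib_right)
    show "affine_pairing (r *\<^sub>R z) w = r *\<^sub>R affine_pairing z w" for r z
      by (simp add: affine_pairing_def linear_scale[OF linear_pairing] distrib_left)
  qed
  from linear_sum[OF this, of "\<lambda>i. u i *\<^sub>R z i" I] linear_scale[OF this] show ?thesis
    by simp
qed

lemma continuous_on_pairing [continuous_intros]:
  assumes "continuous_on S f"
  shows "continuous_on S (\<lambda>p. pairing (f p) x)"
proof -
  have "continuous_on UNIV (\<lambda>p. pairing p x)"
    unfolding continuous_on_open_vimage[OF open_UNIV]
    by (auto simp: open_dual_def intro!: generate_topology.Basis)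
  from continuous_on_compose2[OF this assms] show ?thesis by simp
qed

text \<open>A basic neighbourhood of \<open>w\<close> missing \<open>S\<close> is cut out by
  finitely many functionals of the form \<open>affine_pairing i\<close>, so the finite-dimensional
  separation applies.\<close>

lemma dual_strict_separation:
  fixes S :: "('x::{real_vector, topological_space} dual \<times> real) set"
  assumes "convex S" "w \<notin> closure S"
  obtains z \<delta> where "\<delta> > 0" "\<And>s. s \<in> S \<Longrightarrow> affine_pairing z w + \<delta> \<le> affine_pairing z s"
proof -
  have "open (- closure S)" "w \<in> - closure S"
    using assms by (auto simp: open_Compl)
  then obtain A B where AB: "open A" "open B" "w \<in> A \<times> B" "A \<times> B \<subseteq> - closure S"
    by (rule open_prod_elim)
  have w: "fst w \<in> A" "snd w \<in> B"
    using AB(3) by (auto simp: mem_Times_iff)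
  obtain F e where F: "finite F" "e > 0"
    "\<forall>p'. (\<forall>x\<in>F. \<bar>pairing p' x - pairing (fst w) x\<bar> < e) \<longrightarrow> p' \<in> A"
    by (rule dual_open_contains_basic[OF AB(1) w(1)])
  obtain e' where e': "e' > 0" "\<And>y. \<bar>y - snd w\<bar> < e' \<Longrightarrow> y \<in> B"
    using AB(2) w(2) by (auto simp: open_dist dist_real_def)
  \<comment> \<open>The point \<open>(0, 1)\<close> reads off the real coordinate; the points
    \<open>(x, 0)\<close> evaluate the dual component.\<close>
  define I where "I = insert (0::'x, 1::real) ((\<lambda>x. (x, 0)) ` F)"
  have far: "\<exists>i\<in>I. min e e' \<le> \<bar>affine_pairing i s - affine_pairing i w\<bar>" if "s \<in> S" for s
  proof (rule ccontr)
    assume "\<not> ?thesis"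
    then have near: "\<bar>affine_pairing i s - affine_pairing i w\<bar> < min e e'" if "i \<in> I" for i
      using that by (meson not_le)
    have "fst s \<in> A"
      by (rule F(3)[rule_format]) (use near[of "(_, 0)"] in \<open>simp add: I_def affine_pairing_def\<close>)
    moreover have "snd s \<in> B"
      by (rule e'(2)) (use near[of "(0, 1)"] in \<open>simp add: I_def affine_pairing_def linear_0[OF linear_pairing]\<close>)
    ultimately have "s \<in> A \<times> B" by (simp add: mem_Times_iff)
    with AB(4) \<open>s \<in> S\<close> closure_subset[of S] show False by blast
  qed
  have fin: "finite I" using F(1) by (simp add: I_def)
  have pos: "min e e' > 0" using F(2) e'(1) by simp
  obtain u \<delta> where sep: "\<delta> > 0"
    "\<And>s. s \<in> S \<Longrightarrow> (\<Sum>i\<in>I. u i * affine_pairing i w) + \<delta> \<le> (\<Sum>i\<in>I. u i * affine_pairing i s)"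
    using separation_finitely_many_functionals[OF fin linear_affine_pairing assms(1) pos far] by blast
  show ?thesis
    by (rule that[OF sep(1)]) (rule sep(2)[unfolded affine_pairing_sum_left])
qed

lemma continuous_on_affine_pairing [continuous_intros]:
  assumes "continuous_on S f"
  shows "continuous_on S (\<lambda>s. affine_pairing z (f s))"
  unfolding affine_pairing_def by (intro continuous_intros assms)

text \<open>A point of a segment outside \<open>closure S\<close> would be strictly separated from
  \<open>S\<close> by a closed half-space, which contains \<open>closure S\<close> and hence both
  endpoints.\<close>

lemma convex_closure_dual:
  fixes S :: "('x::{real_vector, topological_space} dual \<times> real) set"
  assumes "convex S"
  shows "convex (closure S)"
proof (rule convexI, rule ccontr)
  fix x y and u v :: real
  assume xy: "x \<in> closure S" "y \<in> closure S" and uv: "0 \<le> u" "0 \<le> v" "u + v = 1"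
    and "u *\<^sub>R x + v *\<^sub>R y \<notin> closure S"
  then obtain z \<delta> where z: "\<delta> > 0"
    "\<And>s. s \<in> S \<Longrightarrow> affine_pairing z (u *\<^sub>R x + v *\<^sub>R y) + \<delta> \<le> affine_pairing z s"
    using dual_strict_separation[OF assms] by metis
  let ?c = "affine_pairing z (u *\<^sub>R x + v *\<^sub>R y) + \<delta>"
  have "closure S \<subseteq> {s. ?c \<le> affine_pairing z s}"
    using z(2) by (intro closure_minimal closed_Collect_le continuous_intros) auto
  with xy have "?c \<le> affine_pairing z x" "?c \<le> affine_pairing z y" by auto
  then have "u * ?c + v * ?c \<le> u * affine_pairing z x + v * affine_pairing z y"
    using uv by (intro add_mono mult_left_mono)
  moreover have "u * ?c + v * ?c = ?c"
    using uv by (metis distrib_right mult_1)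
  ultimately show False
    using z(1) by (simp add: linear_add[OF linear_affine_pairing] linear_scale[OF linear_affine_pairing])
qed

section \<open>Cones and nonvertical separation\<close>

lemma convex_cone_of: "convex B \<Longrightarrow> convex (cone_of B)"
  unfolding cone_of_def cone_hull_expl[symmetric] by (rule convex_cone_hull)

lemma affine_pairing_add: "affine_pairing z (v + w) = affine_pairing z v + affine_pairing z w"
  by (rule linear_add[OF linear_affine_pairing])

lemma affine_pairing_scaleR: "affine_pairing z (r *\<^sub>R w) = r * affine_pairing z w"
  by (simp add: linear_scale[OF linear_affine_pairing])

lemma affine_pairing_vertical: "affine_pairing z (0, 1) = snd z"
  by (simp add: affine_pairing_def zero_dual.rep_eq)

lemma cone_ofI: "v \<in> B \<Longrightarrow> 0 \<le> r \<Longrightarrow> r *\<^sub>R v \<in> cone_of B"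
  unfolding cone_of_def by blast

lemma scaleR_cone_of:
  assumes "v \<in> cone_of B" "0 \<le> r"
  shows "r *\<^sub>R v \<in> cone_of B"
proof -
  obtain u b where "v = u *\<^sub>R b" "0 \<le> u" "b \<in> B"
    using assms(1) unfolding cone_of_def by blast
  then show ?thesis
    using cone_ofI[of b B "r * u"] assms(2) by simp
qed

lemma affine_pairing_le_closure_hull:
  assumes "\<And>s. s \<in> S \<Longrightarrow> affine_pairing z s \<le> \<kappa>" "w \<in> closure (convex hull S)"
  shows "affine_pairing z w \<le> \<kappa>"
proof -
  let ?H = "{w. affine_pairing z w \<le> \<kappa>}"
  have "?H = affine_pairing z -` {..\<kappa>}" by auto
  then have "convex ?H"
    by (simp add: convex_linear_vimage[OF linear_affine_pairing])
  then have "convex hull S \<subseteq> ?H"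
    using assms(1) by (intro hull_minimal) auto
  moreover have "closed ?H"
    by (intro closed_Collect_le continuous_intros)
  ultimately show ?thesis
    using assms(2) closure_minimal by blast
qed

text \<open>A point \<open>x0\<close> at which every element of \<open>S\<close> is nonpositive lets one tilt a vertical separating hyperplane.\<close>

lemma nonvertical_separation:
  fixes S :: "('x::{real_vector, topological_space} dual \<times> real) set"
  assumes "convex S" "w \<notin> closure S"
    and up: "\<And>s r. s \<in> S \<Longrightarrow> r \<ge> 0 \<Longrightarrow> s + r *\<^sub>R (0, 1) \<in> S"
    and x0: "\<And>s. s \<in> S \<Longrightarrow> affine_pairing (x0, -1) s \<le> 0"
  obtains x \<eta> where "\<eta> > 0"
    "\<And>s. s \<in> S \<Longrightarrow> affine_pairing (x, -1) s + \<eta> \<le> affine_pairing (x, -1) w"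
proof (cases "S = {}")
  case True
  then show ?thesis using that[of 1] by simp
next
  case False
  then obtain s0 where s0: "s0 \<in> S" by blast
  obtain z \<delta> where z: "\<delta> > 0" "\<And>s. s \<in> S \<Longrightarrow> affine_pairing z w + \<delta> \<le> affine_pairing z s"
    using dual_strict_separation[OF assms(1,2)] by metis
  have "snd z \<ge> 0"
  proof (rule ccontr)
    assume neg: "\<not> snd z \<ge> 0"
    \<comment> \<open>The height at which \<open>s0\<close>, moved upwards, attains the same value
      as \<open>w\<close>, contradicting the gap.\<close>
    define t where "t = (affine_pairing z s0 - affine_pairing z w) / - snd z"
    have "t \<ge> 0"
      unfolding t_def using neg z(1) z(2)[OF s0] by (intro divide_nonneg_pos) auto
    from z(2)[OF up[OF s0 this]]
    have "affine_pairing z w + \<delta> \<le> affine_pairing z s0 + t * snd z"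
      by (simp add: affine_pairing_add affine_pairing_scaleR affine_pairing_vertical
          del: scaleR_Pair)
    moreover have "t * snd z = affine_pairing z w - affine_pairing z s0"
      using neg by (simp add: t_def field_simps)
    ultimately show False using z(1) by simp
  qed
  define \<alpha> where "\<alpha> = affine_pairing (x0, -1) w"
  \<comment> \<open>So small that adding \<open>\<theta>\<close> times the functional at
    \<open>(x0, -1)\<close> costs at most half of the gap \<open>\<delta>\<close>.\<close>
  define \<theta> where "\<theta> = \<delta> / (2 * (\<bar>\<alpha>\<bar> + 1))"
  have "\<theta> > 0" using z(1) by (simp add: \<theta>_def)
  have "\<theta> * \<bar>\<alpha>\<bar> \<le> \<theta> * (\<bar>\<alpha>\<bar> + 1)"
    using \<open>\<theta> > 0\<close> by (intro mult_left_mono) auto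
  also have "\<dots> = \<delta> / 2"
    by (simp add: \<theta>_def field_simps)
  finally have "\<theta> * \<bar>\<alpha>\<bar> \<le> \<delta> / 2" .
  moreover have "- (\<theta> * \<bar>\<alpha>\<bar>) \<le> \<theta> * \<alpha>"
    using \<open>\<theta> > 0\<close> mult_left_mono[of "- \<bar>\<alpha>\<bar>" \<alpha> \<theta>] by simp
  ultimately have \<theta>\<alpha>: "- (\<delta> / 2) \<le> \<theta> * \<alpha>" by linarith
  define r where "r = snd z + \<theta>"
  have "r > 0" using \<open>snd z \<ge> 0\<close> \<open>\<theta> > 0\<close> by (simp add: r_def)
  \<comment> \<open>The tilted functional \<open>\<theta> *\<^sub>R (x0, -1) - z\<close> has last
    coordinate \<open>- r\<close>, which is negative even when \<open>snd z = 0\<close>; dividing by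
    \<open>r\<close> normalizes it to \<open>(x, -1)\<close>.\<close>
  define x where "x = (1 / r) *\<^sub>R (\<theta> *\<^sub>R x0 - fst z)"
  have x: "r * affine_pairing (x, -1) v = \<theta> * affine_pairing (x0, -1) v - affine_pairing z v" for v
    using \<open>r > 0\<close>
    by (simp add: affine_pairing_def x_def linear_scale[OF linear_pairing]
        linear_diff[OF linear_pairing] field_simps) (simp add: r_def algebra_simps)
  show ?thesis
  proof (rule that)
    show "\<delta> / 2 / r > 0" using z(1) \<open>r > 0\<close> by simp
    fix s assume s: "s \<in> S"
    have "\<theta> * affine_pairing (x0, -1) s \<le> 0"
      using x0[OF s] \<open>\<theta> > 0\<close> by (simp add: mult_le_0_iff)
    then have "r * affine_pairing (x, -1) s + \<delta> / 2 \<le> r * affine_pairing (x, -1) w"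
      using z(2)[OF s] \<theta>\<alpha> unfolding x \<alpha>_def by linarith
    then show "affine_pairing (x, -1) s + \<delta> / 2 / r \<le> affine_pairing (x, -1) w"
      using \<open>r > 0\<close> by (simp add: field_simps)
  qed
qed

section \<open>Solutions, consequences and Farkas' lemma\<close>

definition solutions :: "('x::{real_vector, topological_space} dual \<times> real) set \<Rightarrow> 'x set" where
  "solutions A = {x. \<forall>w\<in>A. affine_pairing (x, -1) w \<le> 0}"

text \<open>This is the cone \<open>N\<close>, the polar of the set of all \<open>(x, -1)\<close>
  with \<open>x\<close> a solution.\<close>

definition consequences ::
    "('x::{real_vector, topological_space} dual \<times> real) set \<Rightarrow> ('x dual \<times> real) set" where
  "consequences A = {w. \<forall>x\<in>solutions A. affine_pairing (x, -1) w \<le> 0}"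

lemma closed_consequences: "closed (consequences A)"
proof -
  have "consequences A = (\<Inter>x\<in>solutions A. {w. affine_pairing (x, -1) w \<le> 0})"
    by (auto simp: consequences_def)
  also have "closed \<dots>"
    by (intro closed_INT ballI closed_Collect_le continuous_intros)
  finally show ?thesis .
qed

lemma cone_of_subset_consequences:
  "cone_of (closure (convex hull (insert (0, 1) A))) \<subseteq> consequences A"
proof
  fix w assume "w \<in> cone_of (closure (convex hull (insert (0, 1) A)))"
  then obtain r v where w: "w = r *\<^sub>R v" "r \<ge> 0" "v \<in> closure (convex hull (insert (0, 1) A))"
    by (auto simp: cone_of_def)
  have "affine_pairing (x, -1) v \<le> 0" if "x \<in> solutions A" for x
    by (rule affine_pairing_le_closure_hull[OF _ w(3)])
      (use that in \<open>auto simp: solutions_def affine_pairing_vertical\<close>)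
  then show "w \<in> consequences A"
    using w(1,2) by (simp add: consequences_def affine_pairing_scaleR mult_nonneg_nonpos)
qed

text \<open>A point \<open>w\<close> outside the closed cone is separated by some
  \<open>(x, -1)\<close>. Boundedness above on a cone means nonpositivity on it, so \<open>x\<close>
  is a solution; since the cone contains 0, the value at \<open>w\<close> is positive, so
  \<open>w\<close> is not a consequence.\<close>

lemma farkas:
  assumes "solutions A \<noteq> {}"
  shows "consequences A \<subseteq> closure (cone_of (closure (convex hull (insert (0, 1) A))))"
    (is "_ \<subseteq> closure (cone_of ?C)")
proof (rule subsetI, rule ccontr)
  fix w assume w: "w \<in> consequences A" "w \<notin> closure (cone_of ?C)"
  obtain x0 where x0: "x0 \<in> solutions A" using assms by blast
  have conv: "convex (cone_of ?C)"
    by (intro convex_cone_of convex_closure_dual convex_convex_hull)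
  have C: "v \<in> ?C" if "v \<in> insert (0, 1) A" for v
    using that by (meson closure_subset hull_inc subsetD)
  have incl: "r *\<^sub>R v \<in> cone_of ?C" if "v \<in> insert (0, 1) A" "r \<ge> 0" for r v
    by (rule cone_ofI[OF C[OF that(1)] that(2)])
  have up: "s + r *\<^sub>R (0, 1) \<in> cone_of ?C" if "s \<in> cone_of ?C" "r \<ge> 0" for s r
  proof -
    \<comment> \<open>A sum written as the midpoint of doubled vectors, so that convexity and
      scaling suffice.\<close>
    have "(1/2) *\<^sub>R (2 *\<^sub>R s) + (1/2) *\<^sub>R ((2 * r) *\<^sub>R (0, 1)) \<in> cone_of ?C"
      by (rule convexD[OF conv scaleR_cone_of incl]) (use that in auto)
    then show ?thesis by simp
  qed
  have below: "affine_pairing (x0, -1) s \<le> 0" if "s \<in> cone_of ?C" for s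
    using that x0 cone_of_subset_consequences[of A] by (auto simp: consequences_def)
  obtain x \<eta> where x: "\<eta> > 0"
    "\<And>s. s \<in> cone_of ?C \<Longrightarrow> affine_pairing (x, -1) s + \<eta> \<le> affine_pairing (x, -1) w"
    using nonvertical_separation[OF conv w(2) up below] by metis
  have "affine_pairing (x, -1) v \<le> 0" if "v \<in> A" for v
  proof (rule ccontr)
    assume "\<not> ?thesis"
    then have pos: "affine_pairing (x, -1) v > 0" by simp
    \<comment> \<open>Scaling \<open>v\<close> by \<open>r\<close> makes its value reach the
      absolute value at \<open>w\<close>, which leaves no room for \<open>\<eta>\<close>.\<close>
    define r where "r = \<bar>affine_pairing (x, -1) w\<bar> / affine_pairing (x, -1) v"
    have "r *\<^sub>R v \<in> cone_of ?C"
      using that pos by (intro incl) (auto simp: r_def)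
    from x(2)[OF this] x(1) pos show False
      by (simp add: affine_pairing_scaleR r_def)
  qed
  then have "x \<in> solutions A" by (simp add: solutions_def)
  with w(1) have "affine_pairing (x, -1) w \<le> 0" by (simp add: consequences_def)
  moreover have "\<eta> \<le> affine_pairing (x, -1) w"
    using x(2)[OF incl[of "(0, 1)" 0]] by (simp add: affine_pairing_def zero_dual.rep_eq linear_0[OF linear_pairing])
  ultimately show False using x(1) by simp
qed

section \<open>Limits of convex combinations and the generator \<open>(0, 1)\<close>\<close>

text \<open>Minimality forces the weight of \<open>(0, 1)\<close> in the convex combinations approximating \<open>w\<close>
  to vanish in the limit.\<close>

lemma minimal_consequence_le:
  assumes "A \<noteq> {}" "w \<in> closure (convex hull (insert (0, 1) A))"
    and minimal: "\<And>\<rho>. \<rho> > 0 \<Longrightarrow> w - \<rho> *\<^sub>R (0, 1) \<notin> consequences A"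
    and \<kappa>: "\<And>v. v \<in> A \<Longrightarrow> affine_pairing (x, -1) v \<le> \<kappa>"
  shows "affine_pairing (x, -1) w \<le> \<kappa>"
proof -
  \<comment> \<open>Each combination is recorded together with the weight of its part in the hull of
    \<open>A\<close>, so that a limit weight is available at \<open>w\<close>.\<close>
  define G where "G = {((1 - \<mu>) *\<^sub>R (0, 1) + \<mu> *\<^sub>R d, \<mu>) | \<mu> d. 0 \<le> \<mu> \<and> \<mu> \<le> 1 \<and> d \<in> convex hull A}"
  have "fst ` G = convex hull (insert (0, 1) A)"
    using assms(1) by (force simp: G_def convex_hull_insert_alt image_iff simp del: scaleR_Pair)
  with assms(2) have "w \<in> closure (fst ` G)" by simp
  moreover have "snd ` G \<subseteq> {0..1}" by (auto simp: G_def)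
  ultimately obtain \<mu> where \<mu>: "\<mu> \<in> {0..1}" "(w, \<mu>) \<in> closure G"
    using mem_closure_fst_imp_compact[OF compact_Icc] by metis
  \<comment> \<open>The generator \<open>(0, 1)\<close> has value -1 at \<open>(y, -1)\<close>, so
    its weight \<open>1 - \<mu>\<close> improves the bound. The inequality is closed in the pair and
    passes from \<open>G\<close> to \<open>(w, \<mu>)\<close>.\<close>
  have key: "affine_pairing (y, -1) w + (1 - \<mu>) \<le> \<mu> * \<nu>"
    if y: "\<And>v. v \<in> A \<Longrightarrow> affine_pairing (y, -1) v \<le> \<nu>" for y \<nu>
  proof -
    have "affine_pairing (y, -1) d \<le> \<nu>" if "d \<in> convex hull A" for d
      using affine_pairing_le_closure_hull[OF y] that closure_subset by blast
    then have "G \<subseteq> {g. affine_pairing (y, -1) (fst g) + (1 - snd g) \<le> snd g * \<nu>}" (is "_ \<subseteq> ?P")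
      by (auto simp: G_def affine_pairing_add affine_pairing_scaleR affine_pairing_vertical
          mult_left_mono simp del: scaleR_Pair)
    moreover have "closed ?P"
      by (intro closed_Collect_le continuous_intros)
    ultimately have "closure G \<subseteq> ?P" by (rule closure_minimal)
    with \<mu>(2) show ?thesis by auto
  qed
  \<comment> \<open>At solutions \<open>\<nu> = 0\<close> is allowed, so \<open>w\<close> could be
    lowered by \<open>1 - \<mu>\<close>; minimality therefore gives
    \<open>\<mu> = 1\<close>.\<close>
  have "affine_pairing (y, -1) w + (1 - \<mu>) \<le> \<mu> * 0" if "y \<in> solutions A" for y
    by (rule key) (use that in \<open>simp add: solutions_def\<close>)
  then have "affine_pairing (y, -1) w \<le> \<mu> - 1" if "y \<in> solutions A" for y
    using that by fastforce
  then have "w - (1 - \<mu>) *\<^sub>R (0, 1) \<in> consequences A"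
    by (simp add: consequences_def linear_diff[OF linear_affine_pairing]
        affine_pairing_scaleR affine_pairing_vertical del: scaleR_Pair)
  with minimal[of "1 - \<mu>"] \<mu>(1) have "\<mu> = 1" by force
  with key[OF \<kappa>] show ?thesis by simp
qed

text \<open>The support condition places \<open>w\<close> divided by \<open>l\<close> in the closure
  of \<open>E\<close>, the hull of \<open>A\<close> extended upwards. Scaling
  \<open>d + \<rho> *\<^sub>R (0, 1)\<close> by \<open>1 / (1 + \<rho>)\<close> gives a convex
  combination of \<open>d\<close> and \<open>(0, 1)\<close>; these factors stay in a compact
  interval, and \<open>x0\<close> keeps their limit positive, so the scaling can be undone.\<close>

lemma mem_cone_of_if_le_support:
  assumes "x0 \<in> solutions A" "l > 0"
    and support: "\<And>x \<epsilon>. \<epsilon> > 0 \<Longrightarrow>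
      \<exists>d\<in>A. affine_pairing (x, -1) w \<le> l * affine_pairing (x, -1) d + \<epsilon>"
  shows "w \<in> cone_of (closure (convex hull (insert (0, 1) A)))"
proof -
  define e where "e = (1 / l) *\<^sub>R w"
  define E where "E = {d + \<rho> *\<^sub>R (0, 1) | d \<rho>. d \<in> convex hull A \<and> \<rho> \<ge> 0}"
  have E_I: "d + \<rho> *\<^sub>R (0, 1) \<in> E" if "d \<in> convex hull A" "\<rho> \<ge> 0" for d \<rho>
    unfolding E_def using that by blast
  have E_E: "\<exists>d \<rho>. s = d + \<rho> *\<^sub>R (0, 1) \<and> d \<in> convex hull A \<and> \<rho> \<ge> 0" if "s \<in> E" for s
    using that unfolding E_def by blast
  have x0: "affine_pairing (x0, -1) d \<le> 0" if "d \<in> convex hull A" for d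
    using affine_pairing_le_closure_hull[of A "(x0, -1)" 0 d] assms(1) that closure_subset
    by (auto simp: solutions_def)
  have "e \<in> closure E"
  proof (rule ccontr)
    assume e: "e \<notin> closure E"
    have "convex E"
    proof (rule convexI)
      fix v w and s t :: real
      assume "v \<in> E" "w \<in> E" and st: "0 \<le> s" "0 \<le> t" "s + t = 1"
      then obtain c \<rho> d \<sigma> where *: "v = c + \<rho> *\<^sub>R (0, 1)" "w = d + \<sigma> *\<^sub>R (0, 1)"
        "c \<in> convex hull A" "d \<in> convex hull A" "\<rho> \<ge> 0" "\<sigma> \<ge> 0"
        using E_E by metis
      have "s *\<^sub>R v + t *\<^sub>R w = (s *\<^sub>R c + t *\<^sub>R d) + (s * \<rho> + t * \<sigma>) *\<^sub>R (0, 1)"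
        unfolding *(1,2) by (simp add: scaleR_add_right scaleR_add_left del: scaleR_Pair)
      moreover have "s *\<^sub>R c + t *\<^sub>R d \<in> convex hull A"
        by (rule convexD[OF convex_convex_hull *(3,4) st])
      moreover have "s * \<rho> + t * \<sigma> \<ge> 0" using * st by simp
      ultimately show "s *\<^sub>R v + t *\<^sub>R w \<in> E"
        using E_I by metis
    qed
    moreover have "s + r *\<^sub>R (0, 1) \<in> E" if "s \<in> E" "r \<ge> 0" for s r
    proof -
      obtain d \<rho> where "s = d + \<rho> *\<^sub>R (0, 1)" "d \<in> convex hull A" "\<rho> \<ge> 0"
        using E_E[OF \<open>s \<in> E\<close>] by metis
      moreover from this have "s + r *\<^sub>R (0, 1) = d + (\<rho> + r) *\<^sub>R (0, 1)"
        by (simp add: scaleR_add_left del: scaleR_Pair)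
      ultimately show ?thesis
        using E_I \<open>r \<ge> 0\<close> by (metis add_nonneg_nonneg)
    qed
    moreover have "affine_pairing (x0, -1) s \<le> 0" if "s \<in> E" for s
      using that x0 by (force simp: E_def affine_pairing_add affine_pairing_scaleR
          affine_pairing_vertical simp del: scaleR_Pair)
    ultimately obtain x \<eta> where x: "\<eta> > 0"
      "\<And>s. s \<in> E \<Longrightarrow> affine_pairing (x, -1) s + \<eta> \<le> affine_pairing (x, -1) e"
      using nonvertical_separation[OF _ e] by metis
    \<comment> \<open>The tolerance is half of the gap \<open>\<eta>\<close> after multiplication by
      \<open>l\<close>.\<close>
    obtain d where d: "d \<in> A" "affine_pairing (x, -1) w \<le> l * affine_pairing (x, -1) d + l * \<eta> / 2"
      using support[of "l * \<eta> / 2" x] x(1) assms(2) by auto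
    have "d \<in> E"
      using E_I[OF hull_inc[OF d(1)], of 0] by (simp flip: zero_prod_def)
    then have "l * (affine_pairing (x, -1) d + \<eta>) \<le> l * affine_pairing (x, -1) e"
      using assms(2) x(2) by (intro mult_left_mono) simp_all
    moreover have "l * affine_pairing (x, -1) e = affine_pairing (x, -1) w"
      using assms(2) by (simp add: e_def affine_pairing_scaleR)
    moreover have "l * \<eta> > 0" using assms(2) x(1) by simp
    ultimately show False using d(2) by (simp add: distrib_left)
  qed
  define G where "G = {(d + \<rho> *\<^sub>R (0, 1), 1 / (1 + \<rho>)) | d \<rho>. d \<in> convex hull A \<and> \<rho> \<ge> 0}"
  have "fst ` G = E"
    by (force simp: G_def E_def image_iff simp del: scaleR_Pair)
  with \<open>e \<in> closure E\<close> have "e \<in> closure (fst ` G)" by simp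
  moreover have "snd ` G \<subseteq> {0..1}" by (auto simp: G_def)
  ultimately obtain \<mu> where \<mu>: "\<mu> \<in> {0..1}" "(e, \<mu>) \<in> closure G"
    using mem_closure_fst_imp_compact[OF compact_Icc] by metis
  have "\<mu> > 0"
  proof -
    \<comment> \<open>The value of \<open>d + \<rho> *\<^sub>R (0, 1)\<close> at
      \<open>(x0, -1)\<close> is at most \<open>- \<rho>\<close>; multiplied by the factor this
      becomes a closed condition that excludes a zero limit.\<close>
    have "G \<subseteq> {g. snd g * (affine_pairing (x0, -1) (fst g) - 1) \<le> -1}" (is "_ \<subseteq> ?P")
    proof
      fix g assume "g \<in> G"
      then obtain d \<rho> where g: "g = (d + \<rho> *\<^sub>R (0, 1), 1 / (1 + \<rho>))" "d \<in> convex hull A" "\<rho> \<ge> 0"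
        by (auto simp: G_def simp del: scaleR_Pair)
      have "affine_pairing (x0, -1) (fst g) - 1 \<le> - (1 + \<rho>)"
        using x0[OF g(2)] by (simp add: g(1) affine_pairing_add affine_pairing_scaleR
            affine_pairing_vertical del: scaleR_Pair)
      then show "g \<in> ?P"
        using g(3) by (simp add: g(1) divide_le_eq del: scaleR_Pair)
    qed
    moreover have "closed ?P"
      by (intro closed_Collect_le continuous_intros)
    ultimately have "closure G \<subseteq> ?P" by (rule closure_minimal)
    with \<mu>(2) have "\<mu> * (affine_pairing (x0, -1) e - 1) \<le> -1" by auto
    then have "\<mu> \<noteq> 0" by auto
    with \<mu>(1) show ?thesis by simp
  qed
  have "\<mu> *\<^sub>R e \<in> closure (convex hull (insert (0, 1) A))" (is "_ \<in> closure ?H")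
  proof (rule ccontr)
    assume "\<mu> *\<^sub>R e \<notin> closure ?H"
    then obtain z \<delta> where z: "\<delta> > 0"
      "\<And>s. s \<in> ?H \<Longrightarrow> affine_pairing z (\<mu> *\<^sub>R e) + \<delta> \<le> affine_pairing z s"
      using dual_strict_separation[OF convex_convex_hull] by metis
    \<comment> \<open>The product of the factor with a real-valued pairing is continuous in the
      pair, so the separating inequality passes to \<open>(e, \<mu>)\<close>.\<close>
    let ?P = "{g. affine_pairing z (\<mu> *\<^sub>R e) + \<delta> \<le> snd g * affine_pairing z (fst g)}"
    have "G \<subseteq> ?P"
    proof
      fix g assume "g \<in> G"
      then obtain d \<rho> where g: "g = (d + \<rho> *\<^sub>R (0, 1), 1 / (1 + \<rho>))" "d \<in> convex hull A" "\<rho> \<ge> 0"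
        by (auto simp: G_def simp del: scaleR_Pair)
      let ?m = "1 / (1 + \<rho>)"
      have "?m *\<^sub>R (d + \<rho> *\<^sub>R (0, 1)) = (1 - ?m) *\<^sub>R (0, 1) + ?m *\<^sub>R d"
        using g(3) by (simp add: scaleR_add_right field_simps del: scaleR_Pair)
      also have "\<dots> \<in> ?H"
      proof (rule convexD[OF convex_convex_hull])
        show "(0, 1) \<in> ?H" by (simp add: hull_inc)
        show "d \<in> ?H" by (rule subsetD[OF hull_mono[OF subset_insertI] g(2)])
      qed (use g(3) in auto)
      finally show "g \<in> ?P"
        using z(2) by (metis (mono_tags, lifting) affine_pairing_scaleR fst_conv g(1) mem_Collect_eq snd_conv)
    qed
    moreover have "closed ?P"
      by (intro closed_Collect_le continuous_intros)
    ultimately have "closure G \<subseteq> ?P" by (rule closure_minimal)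
    with \<mu>(2) have "affine_pairing z (\<mu> *\<^sub>R e) + \<delta> \<le> \<mu> * affine_pairing z e" by auto
    with z(1) show False by (simp add: affine_pairing_scaleR)
  qed
  moreover have "w = (l / \<mu>) *\<^sub>R (\<mu> *\<^sub>R e)"
    using \<open>\<mu> > 0\<close> assms(2) by (simp add: e_def)
  moreover have "l / \<mu> \<ge> 0" using \<open>\<mu> > 0\<close> assms(2) by simp
  ultimately show ?thesis using cone_ofI by metis
qed

section \<open>The equivalence for a set of pairs\<close>

lemma bounded_above_functional_eq_0:
  assumes "\<And>x. pairing p x \<le> q"
  shows "p = 0"
proof -
  have "pairing p x \<le> 0" for x
  proof (rule ccontr)
    assume "\<not> ?thesis"
    then have "pairing p (((\<bar>q\<bar> + 1) / pairing p x) *\<^sub>R x) = \<bar>q\<bar> + 1"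
      by (simp add: linear_scale[OF linear_pairing])
    with assms[of "((\<bar>q\<bar> + 1) / pairing p x) *\<^sub>R x"] show False by simp
  qed
  from this this[of "- x" for x] have "pairing p x = 0" for x
    by (metis antisym linear_neg[OF linear_pairing] neg_le_0_iff_le)
  then show ?thesis
    by (simp add: fun_eq_iff zero_dual.rep_eq flip: pairing_inject)
qed

lemma consequences_characterization_iff_closed:
  fixes A :: "('x::{real_vector, topological_space} dual \<times> real) set"
  assumes "A \<noteq> {}" "solutions A \<noteq> {}"
  shows "(\<forall>w. w \<in> consequences A \<longleftrightarrow>
            (\<exists>l\<ge>0. \<forall>x. \<forall>\<epsilon>>0. \<exists>d\<in>A. affine_pairing (x, -1) w \<le> l * affine_pairing (x, -1) d + \<epsilon>))
         \<longleftrightarrow> closed (cone_of (closure (convex hull (insert (0, 1) A))))"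
    (is "(\<forall>w. _ \<longleftrightarrow> ?\<Delta> w) \<longleftrightarrow> closed ?M")
proof
  obtain x0 where x0: "x0 \<in> solutions A" using assms(2) by blast
  have sub: "?M \<subseteq> consequences A" by (rule cone_of_subset_consequences)
  {
    assume *: "\<forall>w. w \<in> consequences A \<longleftrightarrow> ?\<Delta> w"
    have "w \<in> ?M" if "w \<in> consequences A" for w
    proof -
      have "?\<Delta> w" using *[THEN spec, of w] that by (rule iffD1)
      then obtain l where "l \<ge> 0" and
        l: "\<forall>x. \<forall>\<epsilon>>0. \<exists>d\<in>A. affine_pairing (x, -1) w \<le> l * affine_pairing (x, -1) d + \<epsilon>"
        by (elim exE conjE)
      show ?thesis
      proof (cases "l = 0")
        \<comment> \<open>With multiplier zero the condition bounds \<open>fst w\<close> above by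
          \<open>snd w\<close> everywhere, so \<open>fst w\<close> vanishes and \<open>w\<close>
          lies on the ray through \<open>(0, 1)\<close>.\<close>
        case True
        have "pairing (fst w) x \<le> snd w" for x
        proof (rule field_le_epsilon)
          fix \<epsilon> :: real assume "\<epsilon> > 0"
          with l obtain d where "affine_pairing (x, -1) w \<le> l * affine_pairing (x, -1) d + \<epsilon>"
            by metis
          with True show "pairing (fst w) x \<le> snd w + \<epsilon>" by (simp add: affine_pairing_def)
        qed
        then have "fst w = 0" "snd w \<ge> 0"
          using bounded_above_functional_eq_0[of "fst w" "snd w"]
          by (simp, metis linear_0[OF linear_pairing])
        then have "w = snd w *\<^sub>R (0, 1)" by (simp add: prod_eq_iff)
        moreover have "(0, 1) \<in> closure (convex hull (insert (0, 1) A))"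
          by (rule closure_subset[THEN subsetD]) (simp add: hull_inc)
        ultimately show ?thesis
          using \<open>snd w \<ge> 0\<close> cone_ofI by metis
      next
        case False
        then show ?thesis
          using \<open>l \<ge> 0\<close> by (intro mem_cone_of_if_le_support[OF x0 _ l[rule_format]]) auto
      qed
    qed
    then have "?M = consequences A" using sub by blast
    then show "closed ?M" using closed_consequences by simp
  }
  {
    assume "closed ?M"
    then have M: "?M = consequences A"
      using farkas[OF assms(2)] sub by (simp add: closure_closed subset_antisym)
    show "\<forall>w. w \<in> consequences A \<longleftrightarrow> ?\<Delta> w"
    proof (intro allI iffI)
      fix w assume w: "w \<in> consequences A"
      define p where "p = fst w"
      have w_le: "pairing p x \<le> snd w" if "x \<in> solutions A" for x
        using w that by (simp add: consequences_def affine_pairing_def p_def)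
      define q where "q = (SUP x\<in>solutions A. pairing p x)"
      have bdd: "bdd_above (pairing p ` solutions A)"
        using w_le by (auto simp: bdd_above_def)
      have le_q: "pairing p x \<le> q" if "x \<in> solutions A" for x
        unfolding q_def using bdd that by (rule cSUP_upper2) simp
      have q_le: "q \<le> q'" if "\<And>x. x \<in> solutions A \<Longrightarrow> pairing p x \<le> q'" for q'
        unfolding q_def using assms(2) that by (rule cSUP_least)
      have "(p, q) \<in> ?M"
        unfolding M using le_q by (simp add: consequences_def affine_pairing_Pair)
      then obtain l v where v: "(p, q) = l *\<^sub>R v" "l \<ge> 0"
        "v \<in> closure (convex hull (insert (0, 1) A))"
        by (auto simp: cone_of_def)
      \<comment> \<open>\<open>w\<close> has the same functional as \<open>(p, q)\<close> and at
        least its height, and a greater height lowers the value at \<open>(x, -1)\<close>.\<close>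
      have w_q: "affine_pairing (x, -1) w \<le> l * affine_pairing (x, -1) v" for x
        using q_le[OF w_le] unfolding affine_pairing_scaleR[symmetric] v(1)[symmetric]
        by (simp add: affine_pairing_def p_def)
      show "?\<Delta> w"
      proof (cases "l = 0")
        case True
        \<comment> \<open>Now \<open>(p, q)\<close> is zero, so the value at \<open>w\<close> is
          nonpositive everywhere and multiplier 0 works with any \<open>d\<close>.\<close>
        obtain d where d: "d \<in> A" using assms(1) by blast
        have "affine_pairing (x, -1) w \<le> 0 * affine_pairing (x, -1) d + \<epsilon>" if "\<epsilon> > 0" for x \<epsilon>
          using w_q[of x] True that by simp
        then show ?thesis
          by (intro exI[of _ 0] conjI allI impI bexI[OF _ d]) auto
      next
        case False
        with v(2) have "l > 0" by simp
        \<comment> \<open>Lowering \<open>v\<close> by \<open>\<rho>\<close> lowers \<open>q\<close>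
          by \<open>l * \<rho>\<close>, below the supremum of \<open>p\<close> over the
          solutions.\<close>
        have minimal: "v - \<rho> *\<^sub>R (0, 1) \<notin> consequences A" if "\<rho> > 0" for \<rho>
        proof
          assume *: "v - \<rho> *\<^sub>R (0, 1) \<in> consequences A"
          have "q \<le> q - l * \<rho>"
          proof (rule q_le)
            fix x assume "x \<in> solutions A"
            with * have "affine_pairing (x, -1) v + \<rho> \<le> 0"
              by (simp add: consequences_def linear_diff[OF linear_affine_pairing]
                  affine_pairing_scaleR affine_pairing_vertical del: scaleR_Pair)
            then have "l * (affine_pairing (x, -1) v + \<rho>) \<le> 0"
              using \<open>l > 0\<close> by (simp add: mult_le_0_iff)
            moreover have "l * affine_pairing (x, -1) v = pairing p x - q"
              unfolding affine_pairing_scaleR[symmetric] v(1)[symmetric]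
              by (simp add: affine_pairing_Pair)
            ultimately show "pairing p x \<le> q - l * \<rho>" by (simp add: distrib_left)
          qed
          with \<open>l > 0\<close> \<open>\<rho> > 0\<close> show False by (simp add: mult_le_0_iff)
        qed
        have "\<exists>d\<in>A. affine_pairing (x, -1) w \<le> l * affine_pairing (x, -1) d + \<epsilon>" if "\<epsilon> > 0" for x \<epsilon>
        proof (rule ccontr)
          assume "\<not> ?thesis"
          \<comment> \<open>Failure at \<open>x\<close> bounds all values on \<open>A\<close> by one
            constant, and minimality transfers this bound to \<open>v\<close>, against
            \<open>w_q\<close>.\<close>
          then have "l * affine_pairing (x, -1) d + \<epsilon> < affine_pairing (x, -1) w" if "d \<in> A" for d
            using that by (meson not_le)
          then have "l * affine_pairing (x, -1) d \<le> affine_pairing (x, -1) w - \<epsilon>" if "d \<in> A" for d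
            using that by (metis add_le_imp_le_diff less_imp_le)
          then have "affine_pairing (x, -1) d \<le> (affine_pairing (x, -1) w - \<epsilon>) / l" if "d \<in> A" for d
            using that \<open>l > 0\<close> by (simp add: pos_le_divide_eq mult.commute)
          from minimal_consequence_le[OF assms(1) v(3) minimal this]
          have "affine_pairing (x, -1) v \<le> (affine_pairing (x, -1) w - \<epsilon>) / l" .
          then have "l * affine_pairing (x, -1) v \<le> affine_pairing (x, -1) w - \<epsilon>"
            using \<open>l > 0\<close> by (simp add: field_simps)
          with w_q[of x] \<open>\<epsilon> > 0\<close> show False by simp
        qed
        then show ?thesis
          by (intro exI[of _ l] conjI allI impI v(2))
      qed
    next
      fix w assume "?\<Delta> w"
      then obtain l where "l \<ge> 0" and
        l: "\<forall>x. \<forall>\<epsilon>>0. \<exists>d\<in>A. affine_pairing (x, -1) w \<le> l * affine_pairing (x, -1) d + \<epsilon>"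
        by (elim exE conjE)
      have "affine_pairing (x, -1) w \<le> 0" if "x \<in> solutions A" for x
      proof (rule field_le_epsilon)
        fix \<epsilon> :: real assume "\<epsilon> > 0"
        then obtain d where "d \<in> A" "affine_pairing (x, -1) w \<le> l * affine_pairing (x, -1) d + \<epsilon>"
          using l[rule_format, of \<epsilon> x] by blast
        moreover have "l * affine_pairing (x, -1) d \<le> 0"
          using that \<open>l \<ge> 0\<close> \<open>d \<in> A\<close> by (simp add: solutions_def mult_nonneg_nonpos)
        ultimately show "affine_pairing (x, -1) w \<le> 0 + \<epsilon>" by simp
      qed
      then show "w \<in> consequences A" by (simp add: consequences_def)
    qed
  }
qed

theorem corollary6p7:
  fixes T :: "'t set"
    and a :: "'t \<Rightarrow> ('x :: locally_convex_t2_space) dual"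
    and b :: "'t \<Rightarrow> real"
  assumes "T \<noteq> {}"
    and "{x. \<forall>t\<in>T. pairing (a t) x \<le> b t} \<noteq> {}"
  shows "(\<forall>(c :: 'x dual) (s :: real).
            (\<forall>x. (\<forall>t\<in>T. pairing (a t) x \<le> b t) \<longrightarrow> s \<le> pairing c x) \<longleftrightarrow>
            (\<exists>l\<ge>0. \<forall>x. \<forall>\<epsilon>>0. \<exists>t\<in>T. s \<le> pairing (c + l *\<^sub>R a t) x - l * b t + \<epsilon>))
         \<longleftrightarrow>
         closed (cone_of (closure (convex hull ({(a t, b t) | t. t \<in> T} \<union> {(0, 1)}))))"
proof -
  define A where "A = (\<lambda>t. (a t, b t)) ` T"
  have sol: "x \<in> solutions A \<longleftrightarrow> (\<forall>t\<in>T. pairing (a t) x \<le> b t)" for x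
    by (simp add: A_def solutions_def affine_pairing_Pair)
  \<comment> \<open>The sign change turns the lower bound on \<open>c\<close> into nonpositivity;
    since negation is a bijection of pairs, quantifying over \<open>w\<close> amounts to quantifying
    over \<open>c\<close> and \<open>s\<close>.\<close>
  have neg: "affine_pairing (x, -1) (- c, - s) = s - pairing c x" for x c s
    by (simp add: affine_pairing_Pair uminus_dual.rep_eq)
  have cons: "(- c, - s) \<in> consequences A \<longleftrightarrow>
      (\<forall>x. (\<forall>t\<in>T. pairing (a t) x \<le> b t) \<longrightarrow> s \<le> pairing c x)" for c s
    by (simp add: consequences_def neg Ball_def sol)
  have supp: "(\<exists>d\<in>A. affine_pairing (x, -1) (- c, - s) \<le> l * affine_pairing (x, -1) d + \<epsilon>) \<longleftrightarrow>
      (\<exists>t\<in>T. s \<le> pairing (c + l *\<^sub>R a t) x - l * b t + \<epsilon>)" for c s l x \<epsilon>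
    unfolding neg by (simp add: A_def affine_pairing_Pair plus_dual.rep_eq scaleR_dual.rep_eq algebra_simps)
  have all_neg: "(\<forall>w. P w) \<longleftrightarrow> (\<forall>c s. P (- c, - s))" for P :: "'x dual \<times> real \<Rightarrow> bool"
    by (metis add.inverse_inverse surj_pair)
  have "{(a t, b t) | t. t \<in> T} \<union> {(0, 1)} = insert (0, 1) A"
    by (auto simp: A_def)
  moreover have "A \<noteq> {}" "solutions A \<noteq> {}"
    using assms sol by (auto simp: A_def)
  ultimately show ?thesis
    using consequences_characterization_iff_closed[of A] unfolding all_neg cons supp by simp
qed

end
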